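(* For $y\in X$ we have \begin{align*} A^*y^{\downarrow\uparrow}&=q^{-\dim y}y^{\downarrow\uparrow}-(q-1)\varphi q^{-\dim y}\sum_{y\text{ covers }z}z^{\downarrow\uparrow},\\ A_+y^{\downarrow\uparrow}&=\frac{q^{N-\dim y}}{q-1}y^{\downarrow\uparrow}+\varphi^{-1}\sum_{z\text{ covers }y}z^{\downarrow\uparrow},\\ A_-y^{\downarrow\uparrow}&=\frac{q^{\dim y}}{q-1}y^{\downarrow\uparrow},\\ Ay^{\downarrow\uparrow}&=\frac{\varphi q^{N-\dim y}-q^{\dim y}}{q-1}y^{\downarrow\uparrow}+\sum_{z\text{ covers }y}z^{\downarrow\uparrow}. \end{align*} Here the sums are over all $z\in X$ satisfying the indicated covering condition.
   Context: Let $q$ be a prime power, $GF(q)$ the field with $q$ elements, $N\ge 1$ an integer, and $\mathbf V$ an $N$-dimensional vector space over $GF(q)$. Let $X$ be the set of all subspaces of $\mathbf V$, ordered by inclusion (the projective geometry $L_N(q)$). For $y,z\in X$, $y$ covers $z$ means $z\subseteq y$ and $\dim y-\dim z=1$. ${\rm Mat}_X(\mathbb C)$ is the algebra of complex matrices with rows and columns indexed by $X$; it acts on $V=\mathbb C^X$ by left multiplication. For $y\in X$, $\hat y\in V$ has $y$-coordinate $1$ and all other coordinates $0$. $A^*\in{\rm Mat}_X(\mathbb C)$ is the diagonal matrix with $(y,y)$-entry $q^{-\dim y}$. $R,L\in{\rm Mat}_X(\mathbb C)$: $R_{y,z}=1$ if $y$ covers $z$ and $0$ otherwise; $L_{y,z}=1$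 if $z$ covers $y$ and $0$ otherwise. Fix a real number $\varphi>0$ and define \[ A=R+\varphi(A^* )^{-1}L+\frac{\varphi-1}{q-1}(A^* )^{-1},\quad A_+=\frac{(A^* )^{-1}}{q-1}+\varphi^{-1}R,\quad A_-=\frac{(A^* )^{-1}}{q-1}-\varphi(A^* )^{-1}L . \] With $[n]_q=\frac{q^n-1}{q-1}$ and $[n]_q^!=[n]_q\cdots[1]_q$ ($[0]_q^!=1$), for nilpotent $\psi$ define $\exp_{q^{-1/2}}(\psi)=\sum_{i\ge0}\frac{1}{[i]_q^!}\psi^i$. For $y\in X$ define $y^{\downarrow\uparrow}=\exp_{q^{-1/2}}(-\varphi L)\hat y$. *)

theory Defs
  imports "HOL-Analysis.Analysis"
begin

text \<open>
  The vector space \<open>\<^bold>V\<close> is a type \<open>'v\<close> with a scalar multiplication \<open>scl\<close> over the finite field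
  \<open>'k\<close>, subject to \<open>vector_space scl\<close>; so \<open>GF(q)\<close> is \<open>'k\<close>, with \<open>q = CARD('k)\<close>. The class constraint
  \<open>finite\<close> on \<open>'v\<close> is no restriction, since a finite-dimensional space over a finite field is finite.
\<close>

definition PG :: "('k::{field,finite} \<Rightarrow> 'v::{ab_group_add,finite} \<Rightarrow> 'v) \<Rightarrow> 'v set set" where
  "PG scl = {W. module.subspace scl W}"

abbreviation sdim :: "('k::{field,finite} \<Rightarrow> 'v::{ab_group_add,finite} \<Rightarrow> 'v) \<Rightarrow> 'v set \<Rightarrow> nat" where
  "sdim scl \<equiv> vector_space.dim scl"

definition covers ::
  "('k::{field,finite} \<Rightarrow> 'v::{ab_group_add,finite} \<Rightarrow> 'v) \<Rightarrow> 'v set \<Rightarrow> 'v set \<Rightarrow> bool" where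
  "covers scl y z \<longleftrightarrow>
     y \<in> PG scl \<and> z \<in> PG scl \<and> z \<subseteq> y \<and> int (sdim scl y) - int (sdim scl z) = 1"

text \<open>
  The set \<open>X = PG scl\<close> depends on the term \<open>scl\<close>, so it cannot be a type. The matrices and vectors
  are therefore indexed by the finite type \<open>'v set\<close> of all subsets of \<open>\<^bold>V\<close>, and \<open>Mat\<^sub>X(\<complex>)\<close> is the
  algebra of those matrices that vanish outside \<open>X \<times> X\<close>. Its unit is \<open>idX\<close> (not \<open>mat 1\<close>), and powers
  and inverses are taken with respect to this unit.
\<close>

type_synonym 'v cvec = "complex ^ 'v set"
type_synonym 'v cmat = "complex ^ 'v set ^ 'v set"

definition MatX :: "('k::{field,finite} \<Rightarrow> 'v::{ab_group_add,finite} \<Rightarrow> 'v) \<Rightarrow> 'v cmat set" where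
  "MatX scl = {M. \<forall>y z. y \<notin> PG scl \<or> z \<notin> PG scl \<longrightarrow> M $ y $ z = 0}"

definition idX :: "('k::{field,finite} \<Rightarrow> 'v::{ab_group_add,finite} \<Rightarrow> 'v) \<Rightarrow> 'v cmat" where
  "idX scl = (\<chi> y z. if y \<in> PG scl \<and> y = z then 1 else 0)"

definition invX ::
  "('k::{field,finite} \<Rightarrow> 'v::{ab_group_add,finite} \<Rightarrow> 'v) \<Rightarrow> 'v cmat \<Rightarrow> 'v cmat" where
  "invX scl M = (THE B. B \<in> MatX scl \<and> M ** B = idX scl \<and> B ** M = idX scl)"

primrec powX ::
  "('k::{field,finite} \<Rightarrow> 'v::{ab_group_add,finite} \<Rightarrow> 'v) \<Rightarrow> 'v cmat \<Rightarrow> nat \<Rightarrow> 'v cmat" where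
  "powX scl M 0 = idX scl"
| "powX scl M (Suc i) = M ** powX scl M i"

definition Astar :: "('k::{field,finite} \<Rightarrow> 'v::{ab_group_add,finite} \<Rightarrow> 'v) \<Rightarrow> 'v cmat" where
  "Astar scl = (\<chi> y z. if y \<in> PG scl \<and> y = z
                       then of_nat CARD('k) powi (- int (sdim scl y)) else 0)"

definition Rmat :: "('k::{field,finite} \<Rightarrow> 'v::{ab_group_add,finite} \<Rightarrow> 'v) \<Rightarrow> 'v cmat" where
  "Rmat scl = (\<chi> y z. if covers scl y z then 1 else 0)"

definition Lmat :: "('k::{field,finite} \<Rightarrow> 'v::{ab_group_add,finite} \<Rightarrow> 'v) \<Rightarrow> 'v cmat" where
  "Lmat scl = (\<chi> y z. if covers scl z y then 1 else 0)"

definition Amat ::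
  "('k::{field,finite} \<Rightarrow> 'v::{ab_group_add,finite} \<Rightarrow> 'v) \<Rightarrow> real \<Rightarrow> 'v cmat" where
  "Amat scl \<phi> = Rmat scl + \<phi> *\<^sub>R (invX scl (Astar scl) ** Lmat scl)
      + ((\<phi> - 1) / (real CARD('k) - 1)) *\<^sub>R invX scl (Astar scl)"

definition Aplus ::
  "('k::{field,finite} \<Rightarrow> 'v::{ab_group_add,finite} \<Rightarrow> 'v) \<Rightarrow> real \<Rightarrow> 'v cmat" where
  "Aplus scl \<phi> = (1 / (real CARD('k) - 1)) *\<^sub>R invX scl (Astar scl) + inverse \<phi> *\<^sub>R Rmat scl"

definition Aminus ::
  "('k::{field,finite} \<Rightarrow> 'v::{ab_group_add,finite} \<Rightarrow> 'v) \<Rightarrow> real \<Rightarrow> 'v cmat" where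
  "Aminus scl \<phi> = (1 / (real CARD('k) - 1)) *\<^sub>R invX scl (Astar scl)
      - \<phi> *\<^sub>R (invX scl (Astar scl) ** Lmat scl)"

definition qnum :: "nat \<Rightarrow> nat \<Rightarrow> real" where
  "qnum q n = (real q ^ n - 1) / (real q - 1)"

definition qfact :: "nat \<Rightarrow> nat \<Rightarrow> real" where
  "qfact q n = (\<Prod>i=1..n. qnum q i)"

text \<open>
  The exponential with parameter \<open>q powr (-1/2)\<close>, whose factorials are the \<open>qfact q i\<close> above. Meant for nilpotent \<open>M\<close>, where only finitely many terms are nonzero.
\<close>

definition qexp ::
  "('k::{field,finite} \<Rightarrow> 'v::{ab_group_add,finite} \<Rightarrow> 'v) \<Rightarrow> 'v cmat \<Rightarrow> 'v cmat" where
  "qexp scl M = (\<Sum>i. (1 / qfact CARD('k) i) *\<^sub>R powX scl M i)"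

definition downup ::
  "('k::{field,finite} \<Rightarrow> 'v::{ab_group_add,finite} \<Rightarrow> 'v) \<Rightarrow> real \<Rightarrow> 'v set \<Rightarrow> 'v cvec" where
  "downup scl \<phi> y = qexp scl ((- \<phi>) *\<^sub>R Lmat scl) *v axis y 1"

end

theory Submission
  imports Defs
begin

text \<open>
  Write \<open>K\<close> for the inverse of \<open>A\<^sup>*\<close> and \<open>c\<^sub>i = (-\<phi>)\<^sup>i / [i]\<^sub>q!\<close>, so that \<open>y\<^sup>\<down>\<^sup>\<up>\<close> is the sum of the
  vectors \<open>c\<^sub>i L\<^sup>i y\<close>. Each \<open>L\<^sup>i y\<close> is an eigenvector of \<open>K\<close> and \<open>A\<^sup>*\<close>, and
  \<open>c\<^sub>i\<^sub>+\<^sub>1 (q\<^sup>i\<^sup>+\<^sup>1 - 1) = -(q - 1) \<phi> c\<^sub>i\<close>; shifting the summation index gives the formulas for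
  \<open>A\<^sup>*\<close> and \<open>A\<^sub>-\<close>. Counting covers gives \<open>L R - R L = (q\<^sup>N A\<^sup>* - K) / (q - 1)\<close>, which by induction
  determines \<open>R L\<^sup>i y - L\<^sup>i R y\<close> as a multiple of \<open>L\<^sup>i\<^sup>-\<^sup>1 y\<close> and yields the formula for \<open>A\<^sub>+\<close>. Finally
  \<open>A = \<phi> A\<^sub>+ - A\<^sub>-\<close>.
\<close>

section \<open>Linearity of the matrix action on vectors\<close>

lemma matrix_vector_mult_scaleR_right:
  fixes M :: "'a::real_algebra_1 ^ 'n ^ 'm"
  shows "M *v (c *\<^sub>R x) = c *\<^sub>R (M *v x)"
  by (simp add: vec_eq_iff matrix_vector_mult_def scaleR_sum_right)

lemma matrix_vector_mult_scaleR_left: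
  fixes M :: "'a::real_algebra_1 ^ 'n ^ 'm"
  shows "(c *\<^sub>R M) *v x = c *\<^sub>R (M *v x)"
  by (simp add: vec_eq_iff matrix_vector_mult_def scaleR_sum_right)

lemma matrix_vector_mult_sum_right:
  fixes M :: "'a::ring_1 ^ 'n ^ 'm"
  shows "M *v (\<Sum>i\<in>S. f i) = (\<Sum>i\<in>S. M *v f i)"
  by (induction S rule: infinite_finite_induct) (auto simp: matrix_vector_right_distrib)

lemma matrix_vector_mult_sum_left:
  fixes f :: "'i \<Rightarrow> 'a::ring_1 ^ 'n ^ 'm"
  shows "(\<Sum>i\<in>S. f i) *v x = (\<Sum>i\<in>S. f i *v x)"
  by (induction S rule: infinite_finite_induct) (auto simp: matrix_vector_mult_add_rdistrib)

lemma matrix_vector_mult_axis_nth: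
  fixes M :: "'a::ring_1 ^ 'n ^ 'm"
  shows "(M *v axis k 1) $ i = M $ i $ k"
  by (simp add: matrix_vector_mult_def axis_def if_distrib[of "\<lambda>c. _ * c"] cong: if_cong)

lemma axis_nth: "axis k x $ i = (if i = k then x else 0)"
  by (simp add: axis_def)

lemma matrix_eqI_axis:
  fixes M M' :: "'a::ring_1 ^ 'n ^ 'm"
  assumes "\<And>k. M *v axis k 1 = M' *v axis k 1"
  shows "M = M'"
  unfolding vec_eq_iff using assms by (metis matrix_vector_mult_axis_nth)

text \<open>An entry of a product of two 0-1 matrices counts intermediate indices; this turns the
  entries of \<open>LR\<close> and \<open>RL\<close> into numbers of common covers and of commonly
  covered subspaces.\<close>

lemma sum_indicator_mult:
  fixes P Q :: "'b::finite \<Rightarrow> bool"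
  shows "(\<Sum>w\<in>UNIV. (if P w then 1 else 0) * (if Q w then 1 else 0 :: complex))
    = of_nat (card {w. P w \<and> Q w})"
proof -
  have "(\<Sum>w\<in>UNIV. (if P w then 1 else 0) * (if Q w then 1 else 0 :: complex))
    = (\<Sum>w\<in>UNIV. if P w \<and> Q w then 1 else 0)"
    by (intro sum.cong) auto
  then show ?thesis by (simp add: sum.If_cases)
qed

section \<open>Counting subspaces of a finite vector space\<close>

locale finite_projective_geometry = finite_dimensional_vector_space scl B
  for scl :: "'k::{field,finite} \<Rightarrow> 'v::{ab_group_add,finite} \<Rightarrow> 'v" and B
begin

lemma CARD_gt_1: "CARD('k) > 1"
proof -
  have "card {0, 1 :: 'k} \<le> CARD('k)" by (intro card_mono) auto
  then show ?thesis by simp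
qed

text \<open>Adjoining \<open>v\<close> outside the span multiplies its size by
  \<open>CARD('k)\<close>, since \<open>(k, s)\<close> maps bijectively to
  \<open>scl k v + s\<close>.\<close>

lemma card_span: "independent S \<Longrightarrow> card (span S) = CARD('k) ^ card S"
proof (induction S rule: infinite_finite_induct)
  case (insert v S)
  then have v: "v \<notin> span S" and ind: "independent S"
    by (auto simp: independent_insert)
  let ?f = "\<lambda>(k, s). scl k v + s"
  have "inj_on ?f (UNIV \<times> span S)"
  proof (rule inj_onI, clarify)
    fix k s k' s'
    assume s: "s \<in> span S" and s': "s' \<in> span S" and eq: "scl k v + s = scl k' v + s'"
    have "scl (k - k') v = s' - s"
      using eq by (simp add: scale_left_diff_distrib algebra_simps)
    then have *: "scl (k - k') v \<in> span S"
      using s s' span_diff by metis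
    have "k = k'"
    proof (rule ccontr)
      assume "k \<noteq> k'"
      then have "v = scl (inverse (k - k')) (scl (k - k') v)" by simp
      with * span_scale v show False by metis
    qed
    with eq show "k = k' \<and> s = s'" by simp
  qed
  moreover have "?f ` (UNIV \<times> span S) = span (insert v S)"
  proof (intro set_eqI iffI)
    fix x assume "x \<in> span (insert v S)"
    then obtain k where "x - scl k v \<in> span S" by (auto simp: span_insert)
    then show "x \<in> ?f ` (UNIV \<times> span S)"
      by (intro image_eqI[where x = "(k, x - scl k v)"]) auto
  next
    fix x assume "x \<in> ?f ` (UNIV \<times> span S)"
    then obtain k s where "x = scl k v + s" "s \<in> span S" by auto
    then have "x - scl k v \<in> span S" by simp
    then show "x \<in> span (insert v S)" by (auto simp: span_insert)
  qed
  ultimately have "card (span (insert v S)) = card (UNIV \<times> span S :: ('k \<times> 'v) set)"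
    by (metis card_image)
  then show ?case using insert ind by (simp add: card_cartesian_product)
qed auto

lemma card_subspace:
  assumes "subspace W"
  shows "card W = CARD('k) ^ dim W"
proof -
  obtain S where "S \<subseteq> W" "independent S" "W \<subseteq> span S" "card S = dim W"
    using basis_exists by blast
  then show ?thesis using card_span[of S] span_subspace[of S W] assms by simp
qed

lemma covers_iff:
  "covers scl y z \<longleftrightarrow> subspace y \<and> subspace z \<and> z \<subseteq> y \<and> dim y = Suc (dim z)"
  by (auto simp: covers_def PG_def)

text \<open>The sets \<open>w - u\<close>, for \<open>w\<close> covering \<open>u\<close> inside
  \<open>y\<close>, partition \<open>y - u\<close> into blocks of equal size: a vector
  \<open>v\<close> of \<open>y - u\<close> lies only in the block of
  \<open>span (insert v u)\<close>. Comparing cardinalities gives the count.\<close>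

lemma card_covers_between:
  assumes u: "subspace u" and y: "subspace y" and uy: "u \<subseteq> y"
  shows "real (card {w. covers scl w u \<and> w \<subseteq> y}) = qnum CARD('k) (dim y - dim u)"
proof -
  let ?q = "CARD('k)" and ?C = "{w. covers scl w u \<and> w \<subseteq> y}"
  have un: "y - u = (\<Union>w\<in>?C. w - u)"
  proof (intro set_eqI iffI)
    fix v assume v: "v \<in> y - u"
    let ?w = "span (insert v u)"
    have "v \<notin> span u" using v u by (metis DiffD2 span_eq_iff)
    then have "dim ?w = Suc (dim u)" by (simp add: dim_insert)
    moreover have "?w \<subseteq> y" using v uy y by (intro span_minimal) auto
    moreover have "u \<subseteq> ?w" "v \<in> ?w" by (auto intro: span_base)
    ultimately show "v \<in> (\<Union>w\<in>?C. w - u)" using u v by (auto simp: covers_iff)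
  qed auto
  have unique: "w = span (insert v u)" if "w \<in> ?C" "v \<in> w - u" for w v
  proof -
    have w: "subspace w" "u \<subseteq> w" "dim w = Suc (dim u)" using that by (auto simp: covers_iff)
    have "v \<notin> span u" using that u by (metis DiffD2 span_eq_iff)
    then have "dim (span (insert v u)) = Suc (dim u)" by (simp add: dim_insert)
    moreover have "span (insert v u) \<subseteq> w" using w that by (intro span_minimal) auto
    ultimately show ?thesis using subspace_dim_equal[of "span (insert v u)" w] w by simp
  qed
  have "card (y - u) = (\<Sum>w\<in>?C. card (w - u))"
    unfolding un using unique by (intro card_UN_disjoint) (simp, simp, blast)
  also have "\<dots> = (\<Sum>w\<in>?C. ?q ^ Suc (dim u) - ?q ^ dim u)"
    by (intro sum.cong refl) (auto simp: covers_iff card_Diff_subset card_subspace)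
  also have "card (y - u) = ?q ^ dim y - ?q ^ dim u"
    using assms by (simp add: card_Diff_subset card_subspace)
  finally have eq: "?q ^ dim y - ?q ^ dim u = card ?C * (?q ^ Suc (dim u) - ?q ^ dim u)" by simp
  have le: "dim u \<le> dim y" using uy by (rule dim_subset)
  have "real (?q ^ dim y - ?q ^ dim u) = real ?q ^ dim u * (real ?q ^ (dim y - dim u) - 1)"
    using le CARD_gt_1
    by (simp add: of_nat_diff power_increasing algebra_simps flip: power_add)
  moreover have "real (?q ^ Suc (dim u) - ?q ^ dim u) = real ?q ^ dim u * (real ?q - 1)"
    by (subst of_nat_diff) (auto simp: algebra_simps)
  ultimately have "real ?q ^ dim u * (real ?q ^ (dim y - dim u) - 1)
      = real ?q ^ dim u * (real (card ?C) * (real ?q - 1))"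
    using arg_cong[OF eq, of real] by (simp only: of_nat_mult mult.left_commute)
  then have "real ?q ^ (dim y - dim u) - 1 = real (card ?C) * (real ?q - 1)"
    by (rule mult_left_cancel[THEN iffD1, rotated]) simp
  then show ?thesis using CARD_gt_1 by (simp add: qnum_def)
qed

lemma card_covers:
  assumes "subspace y"
  shows "real (card {w. covers scl w y}) = qnum CARD('k) (dim (UNIV :: 'v set) - dim y)"
  using card_covers_between[of y UNIV] assms by simp

lemma dim_span_Un_Int:
  assumes "subspace y" "subspace z"
  shows "dim (span (y \<union> z)) + dim (y \<inter> z) = dim y + dim z"
proof -
  have "span (y \<union> z) = {a + b | a b. a \<in> y \<and> b \<in> z}"
    unfolding span_Un using assms by (simp add: span_eq_iff[THEN iffD2])
  then show ?thesis using dim_sums_Int[OF assms] by simp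
qed

text \<open>The join lies in \<open>w\<close> and is strictly larger than \<open>y\<close>; since
  \<open>w\<close> is only one dimension larger than \<open>y\<close>, nothing else is left.\<close>

lemma covers_two_imp_eq_span:
  assumes "covers scl w y" "covers scl w z" "y \<noteq> z"
  shows "w = span (y \<union> z)"
proof -
  have *: "subspace w" "subspace y" "subspace z" "y \<subseteq> w" "z \<subseteq> w"
    "dim w = Suc (dim y)" "dim w = Suc (dim z)"
    using assms by (auto simp: covers_iff)
  have le: "span (y \<union> z) \<subseteq> w" using * by (intro span_minimal) auto
  have "\<not> z \<subseteq> y" using subspace_dim_equal[of z y] * assms(3) by auto
  then have "y \<subset> span (y \<union> z)" using span_superset[of "y \<union> z"] by blast
  moreover have "span y = y" using * by simp
  ultimately have "dim y < dim (span (y \<union> z))"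
    using dim_psubset[of y "span (y \<union> z)"] by (simp only: span_span)
  then show ?thesis using subspace_dim_equal[of "span (y \<union> z)" w] le * by simp
qed

text \<open>Dual to the preceding lemma: the meet contains \<open>u\<close> and is strictly smaller
  than \<open>y\<close>.\<close>

lemma two_covers_imp_eq_Int:
  assumes "covers scl y u" "covers scl z u" "y \<noteq> z"
  shows "u = y \<inter> z"
proof -
  have *: "subspace u" "subspace y" "subspace z" "u \<subseteq> y" "u \<subseteq> z"
    "dim y = Suc (dim u)" "dim z = Suc (dim u)"
    using assms by (auto simp: covers_iff)
  have "\<not> y \<subseteq> z" using subspace_dim_equal[of y z] * assms(3) by auto
  then have "y \<inter> z \<subset> y" by auto
  moreover have "span y = y" "span (y \<inter> z) = y \<inter> z" using * by (simp_all add: subspace_inter)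
  ultimately have "dim (y \<inter> z) < dim y"
    using dim_psubset[of "y \<inter> z" y] by (simp only:)
  then show ?thesis using subspace_dim_equal[of u "y \<inter> z"] * by (simp add: subspace_inter)
qed

text \<open>By the modular law, two distinct subspaces of equal dimension have a common cover iff they
  cover a common subspace, and in that case both are unique.\<close>

lemma card_common_covers:
  assumes "y \<noteq> z"
  shows "card {w. covers scl w z \<and> covers scl w y} = card {u. covers scl z u \<and> covers scl y u}"
proof (cases "subspace y \<and> subspace z \<and> dim y = dim z \<and> dim (span (y \<union> z)) = Suc (dim y)")
  case True
  then have "dim y = Suc (dim (y \<inter> z))" using dim_span_Un_Int[of y z] by simp
  then have "covers scl y (y \<inter> z)" "covers scl z (y \<inter> z)"
    using True by (auto simp: covers_iff subspace_inter)
  then have "{u. covers scl z u \<and> covers scl y u} = {y \<inter> z}"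
    using two_covers_imp_eq_Int assms by blast
  moreover have "covers scl (span (y \<union> z)) y" "covers scl (span (y \<union> z)) z"
    using True by (auto simp: covers_iff intro: span_base)
  then have "{w. covers scl w z \<and> covers scl w y} = {span (y \<union> z)}"
    using covers_two_imp_eq_span assms by blast
  ultimately show ?thesis by simp
next
  case False
  have "\<not> (covers scl w z \<and> covers scl w y)" for w
  proof
    assume a: "covers scl w z \<and> covers scl w y"
    then have "w = span (y \<union> z)" using covers_two_imp_eq_span assms by blast
    with a False show False by (auto simp: covers_iff)
  qed
  moreover have "\<not> (covers scl z u \<and> covers scl y u)" for u
  proof
    assume a: "covers scl z u \<and> covers scl y u"
    then have "u = y \<inter> z" using two_covers_imp_eq_Int assms by blast
    with a False show False using dim_span_Un_Int[of y z] by (auto simp: covers_iff)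
  qed
  ultimately show ?thesis by (simp only:)
qed

text \<open>Fix a hyperplane \<open>h\<close> of \<open>y\<close>. Any other hyperplane \<open>z\<close> meets \<open>h\<close> in a hyperplane \<open>u\<close> of \<open>h\<close>,
  and each \<open>u\<close> arises from the \<open>q\<close> subspaces other than \<open>h\<close> strictly between \<open>u\<close> and \<open>y\<close>.\<close>

lemma card_covered:
  assumes "subspace y"
  shows "real (card {z. covers scl y z}) = qnum CARD('k) (dim y)"
  using assms
proof (induction "dim y" arbitrary: y)
  case 0
  then have "{z. covers scl y z} = {}" by (auto simp only: covers_iff)
  moreover have "qnum CARD('k) (dim y) = 0" unfolding 0(1)[symmetric] by (simp add: qnum_def)
  ultimately show ?case by simp
next
  case (Suc d)
  let ?q = "CARD('k)"
  obtain S where S: "S \<subseteq> y" "independent S" "y \<subseteq> span S" "card S = dim y"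
    using basis_exists by blast
  then have "card S = Suc d" using Suc.hyps(2) by (simp only:)
  then have "S \<noteq> {}" by auto
  then obtain v where v: "v \<in> S" by blast
  define h where "h = span (S - {v})"
  have "dim h = d"
    unfolding h_def using S v \<open>card S = Suc d\<close> independent_mono[of S "S - {v}"]
    by (simp add: dim_span_eq_card_independent card_Diff_singleton del: dim_span)
  moreover have "h \<subseteq> y" unfolding h_def using S Suc.prems by (intro span_minimal) auto
  ultimately have h: "covers scl y h" "dim h = d" "subspace h" "h \<subseteq> y"
    using Suc by (auto simp: covers_iff h_def)
  let ?D = "\<lambda>u. {w. covers scl w u \<and> w \<subseteq> y} - {h}"
  have eq: "{z. covers scl y z} = insert h (\<Union>u\<in>{u. covers scl h u}. ?D u)"
  proof (intro set_eqI iffI)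
    fix z assume z: "z \<in> {z. covers scl y z}"
    show "z \<in> insert h (\<Union>u\<in>{u. covers scl h u}. ?D u)"
    proof (cases "z = h")
      case False
      have zh: "subspace z" "dim z = d" "z \<subseteq> y"
        using z Suc.hyps(2) by (auto simp: covers_iff)
      have "y = span (z \<union> h)" using z h False covers_two_imp_eq_span[of y z h] by auto
      then have "dim (z \<inter> h) + Suc d = d + d"
        using dim_span_Un_Int[of z h] zh h Suc.hyps(2) by simp
      then have "covers scl h (z \<inter> h)" "covers scl z (z \<inter> h)"
        using zh h by (auto simp: covers_iff subspace_inter)
      then show ?thesis using zh False by blast
    qed simp
  next
    fix z assume "z \<in> insert h (\<Union>u\<in>{u. covers scl h u}. ?D u)"
    then show "z \<in> {z. covers scl y z}"
      using h Suc.hyps(2) Suc.prems by (auto simp: covers_iff)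
  qed
  have disj: "?D u \<inter> ?D u' = {}" if "covers scl h u" "covers scl h u'" "u \<noteq> u'" for u u'
  proof (rule equals0I)
    fix w assume "w \<in> ?D u \<inter> ?D u'"
    then have "u = w \<inter> h" "u' = w \<inter> h"
      using that two_covers_imp_eq_Int[of w u h] two_covers_imp_eq_Int[of w u' h] by auto
    with that show False by simp
  qed
  have cardD: "real (card (?D u)) = real ?q" if u: "covers scl h u" for u
  proof -
    have "subspace u" "u \<subseteq> y" "dim y - dim u = 2"
      using u h Suc.hyps(2) by (auto simp: covers_iff)
    then have "real (card {w. covers scl w u \<and> w \<subseteq> y}) = qnum ?q 2"
      using card_covers_between[of u y] Suc.prems by simp
    also have "\<dots> = real ?q + 1"
      using CARD_gt_1 by (simp add: qnum_def field_simps power2_eq_square)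
    finally have "card {w. covers scl w u \<and> w \<subseteq> y} = ?q + 1" by linarith
    then show ?thesis using u h(1,4) by (simp add: card_Diff_singleton)
  qed
  have "card {z. covers scl y z} = Suc (card (\<Union>u\<in>{u. covers scl h u}. ?D u))"
    unfolding eq by (subst card_insert_disjoint) auto
  also have "card (\<Union>u\<in>{u. covers scl h u}. ?D u) = (\<Sum>u\<in>{u. covers scl h u}. card (?D u))"
    using disj by (intro card_UN_disjoint) auto
  finally have "real (card {z. covers scl y z}) = 1 + real ?q * qnum ?q d"
    using Suc.hyps(1)[of h] h cardD by simp
  also have "\<dots> = qnum ?q (Suc d)"
    using CARD_gt_1 by (simp add: qnum_def field_simps)
  finally show ?case using Suc.hyps(2) by simp
qed

section \<open>Diagonal matrices of \<open>MatX scl\<close> and the commutation relations\<close>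

definition diagX :: "('v set \<Rightarrow> complex) \<Rightarrow> 'v cmat" where
  "diagX f = (\<chi> y z. if y \<in> PG scl \<and> y = z then f y else 0)"

lemma diagX_nth: "diagX f $ y $ z = (if y = z then if z \<in> PG scl then f z else 0 else 0)"
  by (auto simp: diagX_def)

lemma diagX_mult_left: "(diagX f ** M) $ y $ z = (if y \<in> PG scl then f y * M $ y $ z else 0)"
  by (simp add: matrix_matrix_mult_def diagX_nth if_distrib[of "\<lambda>c. c * _"] cong: if_cong)

lemma diagX_mult_right: "(M ** diagX f) $ y $ z = (if z \<in> PG scl then M $ y $ z * f z else 0)"
  by (simp add: matrix_matrix_mult_def diagX_nth if_distrib[of "\<lambda>c. _ * c"] cong: if_cong)

lemma idX_eq: "idX scl = diagX (\<lambda>_. 1)"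
  by (simp add: idX_def diagX_def)

lemma Astar_eq: "Astar scl = diagX (\<lambda>y. inverse (of_nat CARD('k) ^ dim y))"
  by (simp add: Astar_def diagX_def power_int_minus cong: if_cong)

lemma diagX_in_MatX: "diagX f \<in> MatX scl"
  by (auto simp: MatX_def diagX_def)

lemma idX_mult:
  assumes "M \<in> MatX scl"
  shows "idX scl ** M = M" "M ** idX scl = M"
  using assms by (auto simp: vec_eq_iff idX_eq diagX_mult_left diagX_mult_right MatX_def)

lemma invX_Astar: "invX scl (Astar scl) = diagX (\<lambda>y. of_nat CARD('k) ^ dim y)"
  (is "_ = ?K")
  unfolding invX_def
proof (rule the_equality)
  have *: "Astar scl ** ?K = idX scl" "?K ** Astar scl = idX scl"
    by (auto simp: vec_eq_iff Astar_eq idX_eq diagX_mult_left) (auto simp: diagX_def)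
  then show "?K \<in> MatX scl \<and> Astar scl ** ?K = idX scl \<and> ?K ** Astar scl = idX scl"
    by (simp add: diagX_in_MatX)
  \<comment> \<open>Uniqueness of inverses in a monoid; membership in \<open>MatX scl\<close> is
    what makes \<open>idX scl\<close> act as the unit on \<open>M\<close> and
    \<open>?K\<close>.\<close>
  fix M assume M: "M \<in> MatX scl \<and> Astar scl ** M = idX scl \<and> M ** Astar scl = idX scl"
  then have "M = M ** (Astar scl ** ?K)" by (simp add: * idX_mult)
  also have "\<dots> = idX scl ** ?K" using M by (simp add: matrix_mul_assoc)
  also have "\<dots> = ?K" by (simp add: idX_mult diagX_in_MatX)
  finally show "M = ?K" .
qed

text \<open>A nonzero entry of \<open>Lmat scl\<close> has its column index one dimension above its
  row index, so scaling rows and scaling columns by powers of \<open>CARD('k)\<close> differ by one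
  constant factor.\<close>

lemma invX_Astar_Lmat:
  "invX scl (Astar scl) ** Lmat scl
    = (1 / real CARD('k)) *\<^sub>R (Lmat scl ** invX scl (Astar scl))"
  by (auto simp: vec_eq_iff invX_Astar diagX_mult_left diagX_mult_right Lmat_def covers_iff
      PG_def scaleR_conv_of_real[where 'a = complex])

lemma Astar_Lmat:
  "Astar scl ** Lmat scl = real CARD('k) *\<^sub>R (Lmat scl ** Astar scl)"
  by (auto simp: vec_eq_iff Astar_eq diagX_mult_left diagX_mult_right Lmat_def covers_iff PG_def
      scaleR_conv_of_real[where 'a = complex])

text \<open>Off the diagonal, \<open>LR\<close> and \<open>RL\<close> agree by
  \<open>card_common_covers\<close>. At a subspace \<open>y\<close> on the diagonal they count the
  covers of \<open>y\<close> and the subspaces covered by \<open>y\<close>.\<close>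

lemma Lmat_Rmat:
  "Lmat scl ** Rmat scl = Rmat scl ** Lmat scl + (1 / (real CARD('k) - 1)) *\<^sub>R
    (real CARD('k) ^ dim (UNIV :: 'v set) *\<^sub>R Astar scl - invX scl (Astar scl))"
  (is "_ = _ + ?H")
proof -
  have "(Lmat scl ** Rmat scl) $ z $ y = (Rmat scl ** Lmat scl + ?H) $ z $ y" for y z
  proof -
    have LR: "(Lmat scl ** Rmat scl) $ z $ y = of_nat (card {w. covers scl w z \<and> covers scl w y})"
      unfolding sum_indicator_mult[symmetric]
      by (simp add: matrix_matrix_mult_def Lmat_def Rmat_def)
    have RL: "(Rmat scl ** Lmat scl) $ z $ y = of_nat (card {u. covers scl z u \<and> covers scl y u})"
      unfolding sum_indicator_mult[symmetric]
      by (simp add: matrix_matrix_mult_def Lmat_def Rmat_def)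
    show ?thesis
    proof (cases "y = z \<and> subspace y")
      case True
      then have yz: "y = z" and y: "subspace y" by auto
      let ?q = "real CARD('k)"
      \<comment> \<open>\<open>?h\<close> is the difference of the q-numbers of
        \<open>dim UNIV - dim y\<close> and \<open>dim y\<close>, in which the constants -1
        cancel.\<close>
      let ?h = "(?q ^ dim (UNIV :: 'v set) / ?q ^ dim y - ?q ^ dim y) / (?q - 1)"
      have "dim y \<le> dim (UNIV :: 'v set)" by (intro dim_subset) simp
      then have "real (card {w. covers scl w y}) = real (card {u. covers scl y u}) + ?h"
        using CARD_gt_1 card_covers[OF y] card_covered[OF y]
        by (simp add: qnum_def power_diff diff_divide_distrib)
      then have "complex_of_real (real (card {w. covers scl w y}))
        = of_real (real (card {u. covers scl y u}) + ?h)"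
        by (rule arg_cong)
      then have "(of_nat (card {w. covers scl w y}) :: complex)
        = of_nat (card {u. covers scl y u}) + of_real ?h"
        by (simp only: of_real_add of_real_of_nat_eq)
      moreover have "?H $ z $ y = of_real ?h"
        using yz y
        unfolding invX_Astar unfolding Astar_eq
        by (simp add: diagX_nth PG_def del: dim_UNIV)
          (simp add: scaleR_conv_of_real[where 'a = complex] divide_inverse mult.commute del: dim_UNIV)
      ultimately show ?thesis
        unfolding vector_add_component LR RL unfolding yz by (simp only: conj_absorb)
    next
      case False
      then have "?H $ z $ y = 0"
        unfolding invX_Astar unfolding Astar_eq by (auto simp: diagX_nth PG_def)
      moreover have "card {w. covers scl w z \<and> covers scl w y}
          = card {u. covers scl z u \<and> covers scl y u}"
      proof (cases "y = z")
        case True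
        with False have "{w. covers scl w z \<and> covers scl w y} = {}"
          "{u. covers scl z u \<and> covers scl y u} = {}"
          by (auto simp only: covers_iff)
        then show ?thesis by (simp only:)
      qed (simp add: card_common_covers)
      ultimately show ?thesis unfolding vector_add_component LR RL by (simp only: add_0_right)
    qed
  qed
  then show ?thesis by (simp only: vec_eq_iff) blast
qed

section \<open>Iterated lowering of basis vectors\<close>

lemma Lmat_axis: "Lmat scl *v axis y 1 = (\<Sum>z | covers scl y z. axis z 1)"
  by (simp add: vec_eq_iff matrix_vector_mult_axis_nth Lmat_def axis_nth sum.If_cases)

lemma Rmat_axis: "Rmat scl *v axis y 1 = (\<Sum>z | covers scl z y. axis z 1)"
  by (simp add: vec_eq_iff matrix_vector_mult_axis_nth Rmat_def axis_nth sum.If_cases)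

text \<open>Iterating the action, rather than using \<open>powX\<close>, makes step 0 the identity
  on all vectors, also on those not supported on X.\<close>

definition lowered :: "nat \<Rightarrow> 'v cvec \<Rightarrow> 'v cvec" where
  "lowered i x = ((*v) (Lmat scl) ^^ i) x"

lemma lowered_0: "lowered 0 x = x"
  by (simp add: lowered_def)

lemma lowered_Suc: "lowered (Suc i) x = Lmat scl *v lowered i x"
  by (simp add: lowered_def)

lemma lowered_Lmat: "lowered i (Lmat scl *v x) = lowered (Suc i) x"
  by (simp add: lowered_def funpow_swap1)

lemma lowered_sum: "lowered i (\<Sum>z\<in>S. f z) = (\<Sum>z\<in>S. lowered i (f z))"
  by (induction i) (simp_all add: lowered_0 lowered_Suc matrix_vector_mult_sum_right)

text \<open>Each application of \<open>Lmat scl\<close> lowers the dimension of the supporting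
  subspaces by one. Hence \<open>L\<close> is nilpotent on these vectors, and all later sums are
  finite.\<close>

lemma lowered_axis_nth:
  assumes "subspace y" "lowered i (axis y 1) $ z \<noteq> 0"
  shows "dim z + i = dim y"
  using assms(2)
proof (induction i arbitrary: z)
  case 0
  then show ?case by (auto simp: lowered_0 axis_nth split: if_splits)
next
  case (Suc i)
  then obtain w where "covers scl w z" "lowered i (axis y 1) $ w \<noteq> 0"
    by (auto simp: lowered_Suc matrix_vector_mult_def Lmat_def
        elim!: sum.not_neutral_contains_not_neutral split: if_splits)
  with Suc.IH[of w] show ?case by (simp add: covers_iff)
qed

lemma lowered_axis_eq_0:
  assumes "subspace y" "dim (UNIV :: 'v set) < i"
  shows "lowered i (axis y 1) = 0"
proof -
  have "dim y < i" using assms dim_subset[of y UNIV] by simp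
  then show ?thesis using lowered_axis_nth[OF assms(1), of i] by (fastforce simp: vec_eq_iff)
qed

text \<open>The basis vector \<open>axis y 1\<close> is an eigenvector, and each factor
  \<open>L\<close> moved past the diagonal matrix divides the eigenvalue by
  \<open>CARD('k)\<close>.\<close>

lemma invX_Astar_lowered:
  assumes "subspace y"
  shows "invX scl (Astar scl) *v lowered i (axis y 1)
    = (real CARD('k) ^ dim y / real CARD('k) ^ i) *\<^sub>R lowered i (axis y 1)"
proof (induction i)
  case 0
  show ?case using assms
    by (auto simp: lowered_0 vec_eq_iff matrix_vector_mult_axis_nth invX_Astar diagX_def PG_def
        axis_nth scaleR_conv_of_real[where 'a = complex])
next
  case (Suc i)
  show ?case
    by (simp add: lowered_Suc matrix_vector_mul_assoc invX_Astar_Lmat)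
      (simp add: matrix_vector_mul_assoc[symmetric] matrix_vector_mult_scaleR_left Suc.IH
        matrix_vector_mult_scaleR_right divide_simps)
qed

lemma Astar_lowered:
  assumes "subspace y"
  shows "Astar scl *v lowered i (axis y 1)
    = (real CARD('k) ^ i / real CARD('k) ^ dim y) *\<^sub>R lowered i (axis y 1)"
proof (induction i)
  case 0
  show ?case using assms
    by (auto simp: lowered_0 vec_eq_iff matrix_vector_mult_axis_nth Astar_eq diagX_def PG_def
        axis_nth scaleR_conv_of_real[where 'a = complex] divide_simps)
next
  case (Suc i)
  show ?case
    by (simp add: lowered_Suc matrix_vector_mul_assoc Astar_Lmat)
      (simp add: matrix_vector_mul_assoc[symmetric] matrix_vector_mult_scaleR_left Suc.IH
        matrix_vector_mult_scaleR_right divide_simps)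
qed

lemma Rmat_lowered_Suc:
  assumes "subspace y"
  shows "Rmat scl *v lowered (Suc i) (axis y 1) = Lmat scl *v (Rmat scl *v lowered i (axis y 1)) -
    ((real CARD('k) ^ dim (UNIV :: 'v set) * (real CARD('k) ^ i / real CARD('k) ^ dim y)
      - real CARD('k) ^ dim y / real CARD('k) ^ i) / (real CARD('k) - 1)) *\<^sub>R lowered i (axis y 1)"
proof -
  \<comment> \<open>\<open>comm\<close> is \<open>Lmat_Rmat\<close> applied to a vector, and
    \<open>RL\<close> is \<open>comm\<close> solved for the term in which \<open>R\<close> acts
    last. The bracket then acts on an eigenvector by a scalar.\<close>
  note comm = arg_cong[OF Lmat_Rmat, of "\<lambda>M. M *v _", simplified matrix_vector_mult_add_rdistrib
      matrix_vector_mult_diff_rdistrib matrix_vector_mult_scaleR_left, folded matrix_vector_mul_assoc]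
  note RL = comm[THEN sym, THEN add_implies_diff]
  show ?thesis
    unfolding lowered_Suc RL Astar_lowered[OF assms] invX_Astar_lowered[OF assms]
    by (simp add: algebra_simps diff_divide_distrib)
qed

text \<open>Moving \<open>R\<close> past all the factors \<open>L\<close> adds up the scalars of
  \<open>Rmat_lowered_Suc\<close>; their sum factors through a q-number. Starting at
  \<open>Suc i\<close> avoids a predecessor on the right-hand side.\<close>

lemma Rmat_lowered:
  assumes "subspace y"
  shows "Rmat scl *v lowered (Suc i) (axis y 1) =
    lowered (Suc i) (Rmat scl *v axis y 1) - (qnum CARD('k) (Suc i) *
      ((real CARD('k) ^ dim (UNIV :: 'v set) / real CARD('k) ^ dim y
        - real CARD('k) ^ dim y / real CARD('k) ^ i) / (real CARD('k) - 1)))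
      *\<^sub>R lowered i (axis y 1)"
proof (induction i)
  case 0
  show ?case using CARD_gt_1 Rmat_lowered_Suc[OF assms, of 0]
    by (simp add: lowered_0 lowered_Suc qnum_def)
next
  case (Suc i)
  let ?q = "real CARD('k)"
  have q: "?q > 1" using CARD_gt_1 by simp
  let ?X = "?q ^ dim (UNIV :: 'v set) / ?q ^ dim y" and ?Y = "?q ^ dim y / ?q ^ Suc i"
  have *: "?q ^ dim y / ?q ^ i = ?q * ?Y"
    "?q ^ dim (UNIV :: 'v set) * (?q ^ Suc i / ?q ^ dim y) = ?q ^ Suc i * ?X"
    using q by (simp_all del: dim_UNIV)
  \<comment> \<open>The induction step for the accumulated scalar, as an identity of real numbers:
    old scalar plus new commutator equals new scalar.\<close>
  have "(A - 1) / (r - 1) * ((X - r * Y) / (r - 1)) + (A * X - Y) / (r - 1)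
      = (r * A - 1) / (r - 1) * ((X - Y) / (r - 1))" if "r > 1" for r A X Y :: real
    using that by (simp add: divide_simps) (simp add: algebra_simps)
  from this[OF q, of "?q ^ Suc i" ?X ?Y]
  have "qnum CARD('k) (Suc i) * ((?X - ?q ^ dim y / ?q ^ i) / (?q - 1))
    + (?q ^ dim (UNIV :: 'v set) * (?q ^ Suc i / ?q ^ dim y) - ?Y) / (?q - 1)
    = qnum CARD('k) (Suc (Suc i)) * ((?X - ?Y) / (?q - 1))"
    unfolding * qnum_def power_Suc[of _ "Suc i"] .
  then show ?case
    unfolding Rmat_lowered_Suc[OF assms, of "Suc i"] Suc.IH
    by (simp add: matrix_vector_mult_diff_distrib matrix_vector_mult_scaleR_right
        lowered_Suc[symmetric] scaleR_add_left[symmetric] diff_diff_eq del: dim_UNIV)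
qed

section \<open>The vectors \<open>downup scl \<phi> y\<close> as finite sums\<close>

lemma powX_Lmat_axis:
  "powX scl (c *\<^sub>R Lmat scl) i *v axis y 1
    = (if subspace y then c ^ i *\<^sub>R lowered i (axis y 1) else 0)"
proof (induction i)
  case 0
  \<comment> \<open>\<open>idX scl\<close> kills the basis vectors of sets that are not subspaces,
    whence the second case.\<close>
  show ?case
    by (auto simp: lowered_0 vec_eq_iff matrix_vector_mult_axis_nth axis_nth idX_def PG_def)
next
  case (Suc i)
  then show ?case
    by (simp add: matrix_vector_mul_assoc[symmetric] matrix_vector_mult_scaleR_left
        matrix_vector_mult_scaleR_right lowered_Suc)
qed

definition downup_coeff :: "real \<Rightarrow> nat \<Rightarrow> real" where
  "downup_coeff \<phi> i = (- \<phi>) ^ i / qfact CARD('k) i"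

text \<open>The truncation point \<open>M\<close> is left free and does not depend on
  \<open>y\<close>, so that expansions for different subspaces can be added and the length can be
  adapted to index shifts.\<close>

lemma downup_eq:
  assumes "subspace y" "dim (UNIV :: 'v set) < M"
  shows "downup scl \<phi> y = (\<Sum>i<M. downup_coeff \<phi> i *\<^sub>R lowered i (axis y 1))"
proof -
  \<comment> \<open>The whole matrix power must vanish, so all basis vectors are tested, not only
    \<open>axis y 1\<close>.\<close>
  have "powX scl ((- \<phi>) *\<^sub>R Lmat scl) i = 0" if "i \<ge> M" for i
  proof (rule matrix_eqI_axis)
    fix z
    show "powX scl ((- \<phi>) *\<^sub>R Lmat scl) i *v axis z 1 = 0 *v axis z 1"
      using lowered_axis_eq_0[of z i] that assms(2) by (simp add: powX_Lmat_axis del: scaleR_minus_left dim_UNIV)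
  qed
  then have "qexp scl ((- \<phi>) *\<^sub>R Lmat scl)
    = (\<Sum>i<M. (1 / qfact CARD('k) i) *\<^sub>R powX scl ((- \<phi>) *\<^sub>R Lmat scl) i)"
    unfolding qexp_def by (intro suminf_finite) auto
  then show ?thesis using assms(1)
    by (simp add: downup_def matrix_vector_mult_sum_left matrix_vector_mult_scaleR_left
        powX_Lmat_axis downup_coeff_def del: scaleR_minus_left)
qed

text \<open>With \<open>Z\<close> the set of subspaces covered by \<open>y\<close>, or covering
  \<open>y\<close>, the inner sum of basis vectors is \<open>L\<close> or \<open>R\<close> applied
  to \<open>axis y 1\<close>.\<close>

lemma sum_downup:
  assumes "dim (UNIV :: 'v set) < M" "\<And>z. z \<in> Z \<Longrightarrow> subspace z"
  shows "(\<Sum>z\<in>Z. downup scl \<phi> z)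
    = (\<Sum>i<M. downup_coeff \<phi> i *\<^sub>R lowered i (\<Sum>z\<in>Z. axis z 1))"
proof -
  have "(\<Sum>z\<in>Z. downup scl \<phi> z)
    = (\<Sum>z\<in>Z. \<Sum>i<M. downup_coeff \<phi> i *\<^sub>R lowered i (axis z 1))"
    using assms by (intro sum.cong downup_eq) auto
  also have "\<dots> = (\<Sum>i<M. \<Sum>z\<in>Z. downup_coeff \<phi> i *\<^sub>R lowered i (axis z 1))"
    by (rule sum.swap)
  finally show ?thesis by (simp add: lowered_sum scaleR_sum_right)
qed

lemma qnum_downup_coeff: "qnum CARD('k) (Suc i) * downup_coeff \<phi> (Suc i) = - \<phi> * downup_coeff \<phi> i"
proof -
  have "real CARD('k) ^ Suc i > 1" using CARD_gt_1 by (intro one_less_power) auto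
  then have "qnum CARD('k) (Suc i) \<noteq> 0" using CARD_gt_1 by (simp add: qnum_def)
  moreover have "qfact CARD('k) (Suc i) = qnum CARD('k) (Suc i) * qfact CARD('k) i"
    by (simp add: qfact_def)
  ultimately show ?thesis by (simp add: downup_coeff_def)
qed

text \<open>The index shift behind the formulas for \<open>Astar\<close> and \<open>Aminus\<close>.
  The weight \<open>f\<close> is constantly 1 for the former and the eigenvalue of
  \<open>invX scl (Astar scl)\<close> for the latter.\<close>

lemma sum_shift_downup_coeff:
  assumes "subspace y" "dim (UNIV :: 'v set) < M"
  shows "(\<Sum>i<M. (downup_coeff \<phi> i * (real CARD('k) ^ i - 1) * f i) *\<^sub>R lowered i (axis y 1))
    = (- ((real CARD('k) - 1) * \<phi>)) *\<^sub>R
      (\<Sum>i<M. (downup_coeff \<phi> i * f (Suc i)) *\<^sub>R lowered (Suc i) (axis y 1))"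
    (is "(\<Sum>i<M. ?g i) = _")
proof -
  have c: "downup_coeff \<phi> (Suc i) * (real CARD('k) ^ Suc i - 1)
      = - ((real CARD('k) - 1) * \<phi>) * downup_coeff \<phi> i" for i
  proof -
    have "downup_coeff \<phi> (Suc i) * (real CARD('k) ^ Suc i - 1)
      = (real CARD('k) - 1) * (qnum CARD('k) (Suc i) * downup_coeff \<phi> (Suc i))"
      using CARD_gt_1 by (simp add: qnum_def)
    then show ?thesis unfolding qnum_downup_coeff by simp
  qed
  \<comment> \<open>The added term at \<open>M\<close> is zero by nilpotency, and the term at 0
    drops out because of the factor \<open>CARD('k) ^ 0 - 1\<close>; thus the shift keeps the
    range.\<close>
  have "(\<Sum>i<M. ?g i) = (\<Sum>i<Suc M. ?g i)"
    using lowered_axis_eq_0[OF assms] by simp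
  also have "\<dots> = (\<Sum>i<M. ?g (Suc i))"
    unfolding sum.lessThan_Suc_shift by simp
  finally show ?thesis unfolding c by (simp add: scaleR_sum_right mult.assoc)
qed

section \<open>The action of the four matrices on \<open>downup scl \<phi> y\<close>\<close>

lemma Astar_downup:
  assumes "subspace y"
  shows "Astar scl *v downup scl \<phi> y = (1 / real CARD('k) ^ dim y) *\<^sub>R downup scl \<phi> y
    - ((real CARD('k) - 1) * \<phi> * (1 / real CARD('k) ^ dim y)) *\<^sub>R
      (\<Sum>z | covers scl y z. downup scl \<phi> z)"
proof -
  let ?q = "real CARD('k)" and ?M = "Suc (dim (UNIV :: 'v set))"
  let ?x = "\<lambda>i. lowered i (axis y 1)" and ?c = "downup_coeff \<phi>"
  have "(\<Sum>z | covers scl y z. downup scl \<phi> z) = (\<Sum>i<?M. ?c i *\<^sub>R ?x (Suc i))"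
    by (subst sum_downup[of ?M]) (auto simp: covers_iff Lmat_axis[symmetric] lowered_Lmat)
  then have "(- ((?q - 1) * \<phi>)) *\<^sub>R (\<Sum>z | covers scl y z. downup scl \<phi> z)
      = (\<Sum>i<?M. (?c i * (?q ^ i - 1)) *\<^sub>R ?x i)"
    using sum_shift_downup_coeff[OF assms, of ?M \<phi> "\<lambda>_. 1"] by simp
  \<comment> \<open>Adding the expansion of \<open>downup scl \<phi> y\<close> removes the -1 and
    leaves the eigenvalues of \<open>Astar scl\<close>, up to the factor
    \<open>?q ^ dim y\<close>.\<close>
  also have "\<dots> + downup scl \<phi> y = (\<Sum>i<?M. (?c i * ?q ^ i) *\<^sub>R ?x i)"
    unfolding downup_eq[OF assms lessI] sum.distrib[symmetric]
    by (simp add: algebra_simps)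
  finally have eq: "(- ((?q - 1) * \<phi>)) *\<^sub>R (\<Sum>z | covers scl y z. downup scl \<phi> z) + downup scl \<phi> y
    = (\<Sum>i<?M. (?c i * ?q ^ i) *\<^sub>R ?x i)" .
  have "Astar scl *v downup scl \<phi> y = (1 / ?q ^ dim y) *\<^sub>R (\<Sum>i<?M. (?c i * ?q ^ i) *\<^sub>R ?x i)"
    unfolding downup_eq[OF assms lessI]
    by (simp add: matrix_vector_mult_sum_right matrix_vector_mult_scaleR_right
        Astar_lowered[OF assms] scaleR_sum_right del: sum.lessThan_Suc)
  then show ?thesis unfolding eq[symmetric] by (simp add: scaleR_right_diff_distrib)
qed

lemma invX_Astar_downup:
  assumes "subspace y" "dim (UNIV :: 'v set) < M"
  shows "invX scl (Astar scl) *v downup scl \<phi> y = (\<Sum>i<M. (downup_coeff \<phi> i *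
    (real CARD('k) ^ dim y / real CARD('k) ^ i)) *\<^sub>R lowered i (axis y 1))"
  unfolding downup_eq[OF assms]
  by (simp add: matrix_vector_mult_sum_right matrix_vector_mult_scaleR_right
      invX_Astar_lowered[OF assms(1)])

lemma Aminus_downup:
  assumes "subspace y"
  shows "Aminus scl \<phi> *v downup scl \<phi> y
    = (real CARD('k) ^ dim y / (real CARD('k) - 1)) *\<^sub>R downup scl \<phi> y"
proof -
  let ?q = "real CARD('k)" and ?M = "Suc (dim (UNIV :: 'v set))"
  let ?x = "\<lambda>i. lowered i (axis y 1)" and ?c = "downup_coeff \<phi>"
  let ?f = "\<lambda>i. ?q ^ dim y / ?q ^ i"
  let ?K = "invX scl (Astar scl)"
  have q: "?q - 1 \<noteq> 0" using CARD_gt_1 by simp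
  have KL: "(?K ** Lmat scl) *v downup scl \<phi> y = (\<Sum>i<?M. (?c i * ?f (Suc i)) *\<^sub>R ?x (Suc i))"
    unfolding downup_eq[OF assms lessI] matrix_vector_mult_sum_right matrix_vector_mult_scaleR_right
      matrix_vector_mul_assoc[symmetric] lowered_Suc[symmetric] invX_Astar_lowered[OF assms]
    by (simp only: scaleR_scaleR)
  have "Aminus scl \<phi> *v downup scl \<phi> y = (1 / (?q - 1)) *\<^sub>R
    (?K *v downup scl \<phi> y + (- ((?q - 1) * \<phi>)) *\<^sub>R ((?K ** Lmat scl) *v downup scl \<phi> y))"
    using q by (simp add: Aminus_def matrix_vector_mult_diff_rdistrib matrix_vector_mult_scaleR_left
        scaleR_right_distrib scaleR_right_diff_distrib)
  also have "\<dots> = (1 / (?q - 1)) *\<^sub>R (\<Sum>i<?M. (?c i * ?f i + ?c i * (?q ^ i - 1) * ?f i) *\<^sub>R ?x i)"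
    unfolding KL sum_shift_downup_coeff[OF assms lessI, of \<phi> ?f, symmetric] invX_Astar_downup[OF assms lessI]
    by (simp only: sum.distrib[symmetric] scaleR_left_distrib)
  \<comment> \<open>The weight collapses to \<open>?q ^ i * ?f i = ?q ^ dim y\<close>, independent
    of \<open>i\<close>.\<close>
  also have "(\<Sum>i<?M. (?c i * ?f i + ?c i * (?q ^ i - 1) * ?f i) *\<^sub>R ?x i)
    = ?q ^ dim y *\<^sub>R downup scl \<phi> y"
    unfolding downup_eq[OF assms lessI] scaleR_sum_right
    using q by (intro sum.cong refl) (simp add: field_simps)
  finally show ?thesis by simp
qed

lemma Rmat_downup:
  assumes "subspace y"
  shows "Rmat scl *v downup scl \<phi> y
    = (\<Sum>z | covers scl z y. downup scl \<phi> z) + (\<phi> / (real CARD('k) - 1)) *\<^sub>R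
    ((real CARD('k) ^ dim (UNIV :: 'v set) / real CARD('k) ^ dim y) *\<^sub>R downup scl \<phi> y
      - invX scl (Astar scl) *v downup scl \<phi> y)"
proof -
  let ?q = "real CARD('k)" and ?M = "Suc (dim (UNIV :: 'v set))"
  let ?x = "\<lambda>i. lowered i (axis y 1)" and ?c = "downup_coeff \<phi>"
  let ?e = "Rmat scl *v axis y 1"
  let ?h = "\<lambda>i. ?q ^ dim (UNIV :: 'v set) / ?q ^ dim y - ?q ^ dim y / ?q ^ i"
  \<comment> \<open>One spare summand: after the vanishing term at 0 is dropped, the range is
    \<open>?M\<close>, still long enough for \<open>downup_eq\<close>.\<close>
  have M: "dim (UNIV :: 'v set) < Suc ?M" by (simp del: dim_UNIV)
  have "(\<Sum>z | covers scl z y. downup scl \<phi> z) = (\<Sum>i<Suc ?M. ?c i *\<^sub>R lowered i ?e)"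
    by (subst sum_downup[OF M]) (auto simp: covers_iff Rmat_axis)
  moreover have "Rmat scl *v downup scl \<phi> y = (\<Sum>i<Suc ?M. ?c i *\<^sub>R (Rmat scl *v ?x i))"
    unfolding downup_eq[OF assms M] matrix_vector_mult_sum_right matrix_vector_mult_scaleR_right ..
  ultimately have "Rmat scl *v downup scl \<phi> y - (\<Sum>z | covers scl z y. downup scl \<phi> z)
    = (\<Sum>i<Suc ?M. ?c i *\<^sub>R (Rmat scl *v ?x i - lowered i ?e))"
    by (simp only: sum_subtractf[symmetric] scaleR_right_diff_distrib)
  also have "\<dots> = (\<Sum>i<?M. ?c (Suc i) *\<^sub>R (Rmat scl *v ?x (Suc i) - lowered (Suc i) ?e))"
    unfolding sum.lessThan_Suc_shift[of _ ?M] by (simp add: lowered_0 del: sum.lessThan_Suc)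
  \<comment> \<open>The q-number from \<open>Rmat_lowered\<close> is absorbed by
    \<open>qnum_downup_coeff\<close>, which also supplies the factor \<open>\<phi>\<close>. The
    second part of \<open>?h i\<close> is the eigenvalue of
    \<open>invX scl (Astar scl)\<close>.\<close>
  also have "\<dots> = (\<Sum>i<?M. (\<phi> / (?q - 1)) *\<^sub>R ((?c i * ?h i) *\<^sub>R ?x i))"
  proof (intro sum.cong refl)
    fix i
    have "?c (Suc i) *\<^sub>R (Rmat scl *v ?x (Suc i) - lowered (Suc i) ?e)
      = - (qnum CARD('k) (Suc i) * ?c (Suc i) * (?h i / (?q - 1))) *\<^sub>R ?x i"
      unfolding Rmat_lowered[OF assms] by (simp add: mult_ac del: dim_UNIV)
    then show "?c (Suc i) *\<^sub>R (Rmat scl *v ?x (Suc i) - lowered (Suc i) ?e)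
      = (\<phi> / (?q - 1)) *\<^sub>R ((?c i * ?h i) *\<^sub>R ?x i)"
      unfolding qnum_downup_coeff by (simp add: mult_ac del: dim_UNIV)
  qed
  also have "\<dots> = (\<phi> / (?q - 1)) *\<^sub>R ((?q ^ dim (UNIV :: 'v set) / ?q ^ dim y) *\<^sub>R downup scl \<phi> y
      - invX scl (Astar scl) *v downup scl \<phi> y)"
    unfolding invX_Astar_downup[OF assms lessI] unfolding downup_eq[OF assms lessI]
      scaleR_sum_right sum_subtractf[symmetric]
    by (intro sum.cong refl)
      (simp add: scaleR_left_diff_distrib[symmetric] scaleR_right_diff_distrib[symmetric]
        right_diff_distrib mult_ac del: dim_UNIV)
  finally show ?thesis by (simp add: algebra_simps del: dim_UNIV)
qed

text \<open>The diagonal part of \<open>Aplus scl \<phi>\<close> cancels exactly the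
  \<open>invX scl (Astar scl)\<close> term of \<open>Rmat_downup\<close> after division by
  \<open>\<phi>\<close>.\<close>

lemma Aplus_downup:
  assumes "subspace y" "\<phi> \<noteq> 0"
  shows "Aplus scl \<phi> *v downup scl \<phi> y
    = (real CARD('k) ^ dim (UNIV :: 'v set) / real CARD('k) ^ dim y / (real CARD('k) - 1))
        *\<^sub>R downup scl \<phi> y
      + inverse \<phi> *\<^sub>R (\<Sum>z | covers scl z y. downup scl \<phi> z)"
  unfolding Aplus_def matrix_vector_mult_add_rdistrib matrix_vector_mult_scaleR_left
    Rmat_downup[OF assms(1)]
  using assms(2)
  by (simp add: scaleR_right_distrib scaleR_right_diff_distrib
      mult.assoc[symmetric] mult.commute[of "real CARD('k) - 1"] del: dim_UNIV)

lemma Amat_eq: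
  assumes "\<phi> \<noteq> 0"
  shows "Amat scl \<phi> = \<phi> *\<^sub>R Aplus scl \<phi> - Aminus scl \<phi>"
  using assms
  by (simp add: Amat_def Aplus_def Aminus_def scaleR_right_distrib diff_divide_distrib
      scaleR_left_diff_distrib)

end

theorem lemma15p13:
  fixes scl :: "'k::{field,finite} \<Rightarrow> 'v::{ab_group_add,finite} \<Rightarrow> 'v"
    and q N :: nat and \<phi> :: real and y :: "'v set"
  assumes "vector_space scl"
    and "CARD('k) = q"
    and "vector_space.dim scl (UNIV :: 'v set) = N"
    and "N \<ge> 1"
    and "\<phi> > 0"
    and "y \<in> PG scl"
  shows "(Astar scl *v downup scl \<phi> y =
           (real q powi (- int (sdim scl y))) *\<^sub>R downup scl \<phi> y
           - ((real q - 1) * \<phi> * real q powi (- int (sdim scl y))) *\<^sub>R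
               (\<Sum>z | z \<in> PG scl \<and> covers scl y z. downup scl \<phi> z))
       \<and> (Aplus scl \<phi> *v downup scl \<phi> y =
           (real q powi (int N - int (sdim scl y)) / (real q - 1)) *\<^sub>R downup scl \<phi> y
           + inverse \<phi> *\<^sub>R (\<Sum>z | z \<in> PG scl \<and> covers scl z y. downup scl \<phi> z))
       \<and> (Aminus scl \<phi> *v downup scl \<phi> y =
           (real q ^ sdim scl y / (real q - 1)) *\<^sub>R downup scl \<phi> y)
       \<and> (Amat scl \<phi> *v downup scl \<phi> y =
           ((\<phi> * real q powi (int N - int (sdim scl y)) - real q ^ sdim scl y) / (real q - 1))
             *\<^sub>R downup scl \<phi> y
           + (\<Sum>z | z \<in> PG scl \<and> covers scl z y. downup scl \<phi> z))"
proof -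
  interpret vector_space scl by fact
  \<comment> \<open>Any basis serves to enter the locale; it is finite because the type
    \<open>'v\<close> is.\<close>
  obtain B :: "'v set" where "independent B" "UNIV \<subseteq> span B"
    using basis_exists by blast
  then interpret finite_projective_geometry scl B
    by unfold_locales auto
  have y: "subspace y" using assms(6) by (simp add: PG_def)
  have q: "real q > 1" using CARD_gt_1 assms(2) by simp
  have [simp]: "{z. z \<in> PG scl \<and> covers scl y z} = {z. covers scl y z}"
    "{z. z \<in> PG scl \<and> covers scl z y} = {z. covers scl z y}"
    by (auto simp: covers_def)
  have powi: "real q powi (- int (dim y)) = 1 / real q ^ dim y"
    "real q powi (int N - int (dim y)) = real q ^ N / real q ^ dim y"
    using q by (simp_all add: power_int_minus power_int_diff divide_inverse)
  note eqs = Astar_downup[OF y, of \<phi>] Aminus_downup[OF y, of \<phi>] Aplus_downup[OF y, of \<phi>]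
  note eqs = eqs[unfolded assms(2,3)]
  have "Amat scl \<phi> *v downup scl \<phi> y =
    \<phi> *\<^sub>R (Aplus scl \<phi> *v downup scl \<phi> y) - Aminus scl \<phi> *v downup scl \<phi> y"
    using assms(5)
    by (simp add: Amat_eq matrix_vector_mult_diff_rdistrib matrix_vector_mult_scaleR_left)
  also have "\<dots> = ((\<phi> * (real q ^ N / real q ^ dim y) - real q ^ dim y) / (real q - 1))
      *\<^sub>R downup scl \<phi> y + (\<Sum>z | covers scl z y. downup scl \<phi> z)"
    using eqs(2,3) assms(5)
    by (simp add: scaleR_right_distrib diff_divide_distrib scaleR_left_diff_distrib)
  finally show ?thesis
    unfolding powi using eqs assms(5) by (simp only: simp_thms less_imp_neq not_sym) simp
qed

end
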